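(* Let $q_1,q_2$ be natural integers with $q_1\neq q_2$. For a prime $p$, let $\mathrm{Ma}_{q_1,q_2,p}=\sum_{x\bmod p}\max(q_1x,q_2x)$, where $q_1x$ and $q_2x$ denote the representatives modulo $p$ lying in $[1,p]$. Then, as $p\to\infty$ through primes, $$\mathrm{Ma}_{q_1,q_2,p}=p^2\left(\frac23-\frac{\gcd(q_1,q_2)^2}{12q_1q_2}\right)(1+o(1)).$$ *)

theory Defs
  imports Complex_Main "HOL-Library.Landau_Symbols" "HOL-Number_Theory.Cong"
    "HOL-Computational_Algebra.Primes"
begin

(* The representative of the class of a modulo p lying in [1,p]: it differs from a mod p
   exactly on the zero class, which is represented by p; see rep_mod_unique. *)
definition rep_mod :: "nat \<Rightarrow> nat \<Rightarrow> nat" where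
  "rep_mod p a = (if a mod p = 0 then p else a mod p)"

lemma rep_mod_unique:
  assumes "p > 0"
  shows "r \<in> {1..p} \<and> [r = a] (mod p) \<longleftrightarrow> r = rep_mod p a"
proof (cases "r = p")
  case True
  then show ?thesis
    using less_imp_neq[OF mod_less_divisor[OF assms, of a]] assms
    by (auto simp: rep_mod_def cong_def)
next
  case False
  then show ?thesis
    using assms by (auto simp: rep_mod_def cong_def less_imp_le)
qed

(* The classes x mod p are enumerated by 0,...,p-1; by rep_mod_mult_cong the choice of
   representatives x does not matter. *)
definition Ma :: "nat \<Rightarrow> nat \<Rightarrow> nat \<Rightarrow> nat" where
  "Ma q1 q2 p = (\<Sum>x<p. max (rep_mod p (q1 * x)) (rep_mod p (q2 * x)))"

lemma rep_mod_mult_cong: "[x = y] (mod p) \<Longrightarrow> rep_mod p (q * x) = rep_mod p (q * y)"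
  using cong_scalar_left[of x y p q] by (simp add: rep_mod_def cong_def)

definition primes_at_top :: "nat filter" where
  "primes_at_top = inf at_top (principal {p. prime p})"

end

theory Submission
  imports Defs
begin

text \<open>
  Dividing by the gcd only permutes the classes mod \<open>p\<close>, so let \<open>a > b\<close> be coprime. Let \<open>u, v, w\<close> be the
  residues of \<open>a x\<close>, \<open>b x\<close> and \<open>(a - b) x\<close>. Since \<open>w\<close> is \<open>\<bar>u - v\<bar>\<close> or \<open>p - \<bar>u - v\<bar>\<close>, we have
  \<open>p \<bar>u - v\<bar> = (u - v)\<^sup>2 + w (p - w)\<close>; as each residue permutes \<open>{0..<p}\<close>, only \<open>\<Sum> u v\<close> is not elementary.
  Now \<open>u v / p\<^sup>2\<close> is the value at \<open>x / p\<close> of \<open>frac (a t) * frac (b t)\<close>, a signed sum of four monotone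
  functions on \<open>[0, 1]\<close>, so refining the grid from mesh \<open>1 / p\<close> to mesh \<open>1 / (a b p)\<close> changes its mean by
  \<open>O(1 / p)\<close>. On the finer grid the sum is evaluated exactly by the Chinese remainder theorem.
\<close>

section \<open>Reindexing over residue classes and an exact product sum\<close>

lemma sum_mult_mod:
  fixes f :: "nat \<Rightarrow> 'a::comm_monoid_add"
  assumes "coprime c m" "m > 0"
  shows "(\<Sum>x<m. f (c * x mod m)) = (\<Sum>x<m. f x)"
proof -
  have inj: "inj_on (\<lambda>x. c * x mod m) {..<m}"
  proof (rule inj_onI)
    fix x y assume xy: "x \<in> {..<m}" "y \<in> {..<m}" "c * x mod m = c * y mod m"
    then have "[c * x = c * y] (mod m)" by (simp add: cong_def)
    then have "[x = y] (mod m)" using assms by (simp add: cong_mult_lcancel_nat)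
    then show "x = y" using xy by (simp add: cong_def)
  qed
  moreover have "(\<lambda>x. c * x mod m) ` {..<m} \<subseteq> {..<m}" using assms by auto
  ultimately have "bij_betw (\<lambda>x. c * x mod m) {..<m} {..<m}"
    by (simp add: bij_betw_def endo_inj_surj)
  then show ?thesis by (rule sum.reindex_bij_betw)
qed

text \<open>Chinese remainder theorem: coprimality makes the residue pair injective, and counting
  makes it onto.\<close>

lemma sum_mod_coprime:
  fixes f :: "nat \<Rightarrow> nat \<Rightarrow> 'a::comm_monoid_add"
  assumes "coprime a b" "a > 0" "b > 0"
  shows "(\<Sum>y<a * b. f (y mod a) (y mod b)) = (\<Sum>i<a. \<Sum>j<b. f i j)"
proof -
  let ?h = "\<lambda>y. (y mod a, y mod b)"
  have inj: "inj_on ?h {..<a * b}"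
  proof (rule inj_onI)
    fix x y assume xy: "x \<in> {..<a * b}" "y \<in> {..<a * b}" "?h x = ?h y"
    then have "[x = y] (mod a)" "[x = y] (mod b)" by (simp_all add: cong_def)
    then have "[x = y] (mod a * b)" using assms(1) by (rule coprime_cong_mult_nat)
    then show "x = y" using xy by (simp add: cong_def)
  qed
  have "?h ` {..<a * b} = {..<a} \<times> {..<b}"
  proof (rule card_subset_eq)
    show "?h ` {..<a * b} \<subseteq> {..<a} \<times> {..<b}" using assms by auto
    show "card (?h ` {..<a * b}) = card ({..<a} \<times> {..<b})"
      using card_image[OF inj] by simp
  qed simp
  then have "bij_betw ?h {..<a * b} ({..<a} \<times> {..<b})"
    using inj by (simp add: bij_betw_def)
  from sum.reindex_bij_betw[OF this, of "\<lambda>(i, j). f i j"]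
  show ?thesis by (simp add: sum.cartesian_product)
qed

lemma sum_lessThan_mult:
  fixes f :: "nat \<Rightarrow> 'a::comm_monoid_add"
  shows "(\<Sum>x<n * k. f x) = (\<Sum>i<n. \<Sum>j<k. f (i * k + j))"
proof -
  have "(\<Sum>x<n * k. f x) = (\<Sum>i<n. sum f {i * k..<i * k + k})"
    by (simp add: sum.nat_group)
  also have "\<dots> = (\<Sum>i<n. \<Sum>j<k. f (i * k + j))"
    by (rule sum.cong[OF refl], subst sum.atLeastLessThan_shift_0) (simp add: lessThan_atLeast0)
  finally show ?thesis .
qed

lemma sum_lessThan_real: "(\<Sum>x<n. real x) = real n * (real n - 1) / 2"
  by (induction n) (auto simp: field_simps)

lemma sum_lessThan_real_squares:
  "(\<Sum>x<n. (real x)\<^sup>2) = real n * (real n - 1) * (2 * real n - 1) / 6"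
  by (induction n) (auto simp: field_simps power2_eq_square)

lemma mult_mod_add:
  fixes a n y z :: nat
  assumes "z < n"
  shows "(y * n + z) mod (a * n) = (y mod a) * n + z"
proof -
  have "(y * n + z) mod (n * a) = n * ((y * n + z) div n mod a) + (y * n + z) mod n"
    by (rule mod_mult2_eq)
  then show ?thesis using assms by (simp add: mult.commute)
qed

text \<open>Write \<open>x = y * n + z\<close> with \<open>z < n\<close>; the two residues are then
  \<open>(y mod a) * n + z\<close> and \<open>(y mod b) * n + z\<close>. For fixed \<open>z\<close>
  the Chinese remainder theorem decouples them, and the sum over \<open>y\<close> factors. With
  \<open>n ^ 3\<close> pulled out, the bracket has a limit as \<open>n\<close> grows.\<close>

lemma sum_mod_mult_mod:
  fixes a b n :: nat
  assumes "coprime a b" "a > 0" "b > 0"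
  shows "(\<Sum>x<a * b * n. real (x mod (a * n)) * real (x mod (b * n))) =
    real a * real b * real n ^ 3 *
      ((real a - 1) * (real b - 1) / 4 + (real a + real b - 2) * (1 - 1 / real n) / 4
        + (1 - 1 / real n) * (2 - 1 / real n) / 6)"
proof (cases "n = 0")
  case False
  have inner: "(\<Sum>i<c. real i * real n + z) = real c * (real n * (real c - 1) / 2 + z)"
    for c and z :: real
    by (simp add: sum.distrib sum_lessThan_real algebra_simps flip: sum_distrib_right)
  have "(\<Sum>x<a * b * n. real (x mod (a * n)) * real (x mod (b * n))) =
      (\<Sum>y<a * b. \<Sum>z<n. (real (y mod a) * real n + real z) * (real (y mod b) * real n + real z))"
    unfolding sum_lessThan_mult by (intro sum.cong refl) (simp add: mult_mod_add)
  also have "\<dots> = (\<Sum>z<n. \<Sum>y<a * b. (real (y mod a) * real n + real z) * (real (y mod b) * real n + real z))"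
    by (rule sum.swap)
  also have "\<dots> = (\<Sum>z<n. (\<Sum>i<a. real i * real n + real z) * (\<Sum>j<b. real j * real n + real z))"
    using sum_mod_coprime[OF assms, where f = "\<lambda>i j. (real i * real n + _) * (real j * real n + _)"]
    by (simp add: sum_product)
  also have "\<dots> = (\<Sum>z<n. real a * real b * ((real n)\<^sup>2 * (real a - 1) * (real b - 1) / 4
      + real n * (real a + real b - 2) / 2 * real z + (real z)\<^sup>2))"
    by (intro sum.cong refl, unfold inner) (simp add: field_simps power2_eq_square)
  also have "\<dots> = real a * real b * (real n * ((real n)\<^sup>2 * (real a - 1) * (real b - 1) / 4)
      + real n * (real a + real b - 2) / 2 * (\<Sum>z<n. real z) + (\<Sum>z<n. (real z)\<^sup>2))"
    by (simp only: sum.distrib sum_distrib_left[symmetric] sum_constant card_lessThan)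
  also have "\<dots> = real a * real b * real n ^ 3 *
      ((real a - 1) * (real b - 1) / 4 + (real a + real b - 2) * (1 - 1 / real n) / 4
        + (1 - 1 / real n) * (2 - 1 / real n) / 6)"
    unfolding sum_lessThan_real sum_lessThan_real_squares using False
    by (simp add: field_simps power2_eq_square power3_eq_cube)
  finally show ?thesis .
qed simp

section \<open>Riemann sums under refinement of the grid\<close>

text \<open>By monotonicity the fine sum lies between \<open>k\<close> times the left and
  \<open>k\<close> times the right Riemann sum on the coarse grid. These two differ by a telescoping
  sum.\<close>

lemma refine_grid_mono_on:
  fixes f :: "real \<Rightarrow> real"
  assumes "mono_on {0..1} f" "n > 0" "k > 0"
  shows "\<bar>(\<Sum>x<n * k. f (real x / real (n * k))) - real k * (\<Sum>x<n. f (real x / real n))\<bar>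
    \<le> real k * (f 1 - f 0)"
proof -
  have eq: "(\<Sum>x<n * k. f (real x / real (n * k))) =
      (\<Sum>i<n. \<Sum>j<k. f (real (i * k + j) / real (n * k)))"
    by (rule sum_lessThan_mult)
  have bds: "f (real i / real n) \<le> f (real (i * k + j) / real (n * k))"
    "f (real (i * k + j) / real (n * k)) \<le> f (real (Suc i) / real n)" if "i < n" "j < k" for i j
  proof -
    have j: "real j \<le> real k" and i: "real i + 1 \<le> real n" using that by linarith+
    have 1: "real i / real n \<le> real (i * k + j) / real (n * k)"
      using assms by (simp add: field_simps)
    have 2: "real (i * k + j) / real (n * k) \<le> real (Suc i) / real n"
      using assms j by (simp add: field_simps flip: distrib_left)
    have 3: "0 \<le> real i / real n" "real (Suc i) / real n \<le> 1"
      using assms i by simp_all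
    show "f (real i / real n) \<le> f (real (i * k + j) / real (n * k))"
      by (rule mono_onD[OF assms(1)]) (use 1 2 3 in auto)
    show "f (real (i * k + j) / real (n * k)) \<le> f (real (Suc i) / real n)"
      by (rule mono_onD[OF assms(1)]) (use 1 2 3 in auto)
  qed
  have lo: "real k * (\<Sum>x<n. f (real x / real n)) \<le> (\<Sum>x<n * k. f (real x / real (n * k)))"
  proof -
    have "(\<Sum>i<n. \<Sum>j<k. f (real i / real n)) \<le> (\<Sum>x<n * k. f (real x / real (n * k)))"
      unfolding eq by (intro sum_mono bds) auto
    then show ?thesis by (simp add: sum_distrib_left)
  qed
  have "(\<Sum>x<n * k. f (real x / real (n * k))) \<le> (\<Sum>i<n. \<Sum>j<k. f (real (Suc i) / real n))"
    unfolding eq by (intro sum_mono bds) auto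
  also have "\<dots> = real k * (\<Sum>i<n. f (real (Suc i) / real n))"
    by (simp add: sum_distrib_left)
  also have "(\<Sum>i<n. f (real (Suc i) / real n)) = (\<Sum>i<n. f (real i / real n)) + (f 1 - f 0)"
    using sum_lessThan_telescope[of "\<lambda>i. f (real i / real n)" n] assms
    by (simp add: sum_subtractf algebra_simps)
  finally show ?thesis using lo by (simp add: algebra_simps)
qed

text \<open>Expanding \<open>frac x = x - \<lfloor>x\<rfloor>\<close> in both factors gives four
  products of nonnegative monotone functions. Each product rises from \<open>0\<close> to
  \<open>a * b\<close> on the unit interval and so costs at most \<open>k * a * b\<close>, whence
  the constant \<open>4\<close>.\<close>

lemma refine_grid_frac_product:
  fixes a b n k :: nat
  assumes "n > 0" "k > 0"
  defines "h \<equiv> \<lambda>t::real. frac (real a * t) * frac (real b * t)"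
  shows "\<bar>(\<Sum>x<n * k. h (real x / real (n * k))) - real k * (\<Sum>x<n. h (real x / real n))\<bar>
    \<le> 4 * real a * real b * real k"
proof -
  define D where "D = (\<lambda>f::real \<Rightarrow> real.
    (\<Sum>x<n * k. f (real x / real (n * k))) - real k * (\<Sum>x<n. f (real x / real n)))"
  define f1 f2 f3 f4 :: "real \<Rightarrow> real" where "f1 = (\<lambda>t. (real a * t) * (real b * t))"
    and "f2 = (\<lambda>t. (real a * t) * of_int \<lfloor>real b * t\<rfloor>)"
    and "f3 = (\<lambda>t. of_int \<lfloor>real a * t\<rfloor> * (real b * t))"
    and "f4 = (\<lambda>t. of_int \<lfloor>real a * t\<rfloor> * of_int \<lfloor>real b * t\<rfloor>)"
  have bound: "\<bar>D f\<bar> \<le> real k * (real a * real b)"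
    if "mono_on {0..1} f" "f 0 = 0" "f 1 = real a * real b" for f
    using refine_grid_mono_on[OF that(1) assms(1,2)] that(2,3) by (simp add: D_def)
  have scale: "real c * x \<le> real c * y" if "x \<le> y" for c x y
    using that by (rule mult_left_mono) simp
  then have floor_scale: "real_of_int \<lfloor>real c * x\<rfloor> \<le> real_of_int \<lfloor>real c * y\<rfloor>" if "x \<le> y" for c x y
    using that by (simp add: floor_mono)
  have "mono_on {0..1} f1" "mono_on {0..1} f2" "mono_on {0..1} f3" "mono_on {0..1} f4"
    unfolding f1_def f2_def f3_def f4_def
    by (auto intro!: mono_onI mult_mono scale floor_scale)
  then have "\<bar>D f1\<bar> \<le> real k * (real a * real b)" "\<bar>D f2\<bar> \<le> real k * (real a * real b)"
    "\<bar>D f3\<bar> \<le> real k * (real a * real b)" "\<bar>D f4\<bar> \<le> real k * (real a * real b)"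
    by (auto intro!: bound simp: f1_def f2_def f3_def f4_def)
  moreover have "h = (\<lambda>t. f1 t - f2 t - f3 t + f4 t)"
    by (auto simp: h_def f1_def f2_def f3_def f4_def frac_def algebra_simps)
  then have "D h = D f1 - D f2 - D f3 + D f4"
    by (simp add: D_def sum.distrib sum_subtractf algebra_simps)
  ultimately have "\<bar>D h\<bar> \<le> 4 * (real k * (real a * real b))" by linarith
  then show ?thesis by (simp add: D_def mult_ac)
qed

lemma frac_of_nat_div: "frac (real m / real n) = real (m mod n) / real n"
proof (cases "n = 0")
  case False
  have "real m = real (m div n) * real n + real (m mod n)"
    by (metis of_nat_add of_nat_mult div_mult_mod_eq)
  moreover have "frac (real m / real n) = real m / real n - real (m div n)"
    by (simp add: frac_def floor_divide_of_nat_eq)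
  ultimately show ?thesis using False by (simp add: field_simps)
qed simp

text \<open>The coarse grid \<open>x / p\<close> yields the wanted sum divided by
  \<open>p^2\<close>. On the fine grid \<open>x / (a * b * p)\<close> the factors \<open>a\<close>
  and \<open>b\<close> cancel crosswise, leaving residues modulo \<open>b * p\<close> and
  \<open>a * p\<close>, whose product sum is known exactly.\<close>

lemma sum_mod_product_estimate:
  fixes a b p :: nat
  assumes "coprime a b" "a > 0" "b > 0" "p > 0"
  shows "\<bar>(\<Sum>x<p. real (a * x mod p) * real (b * x mod p)) - real p ^ 3 / (real a * real b) *
      ((real a - 1) * (real b - 1) / 4 + (real a + real b - 2) * (1 - 1 / real p) / 4
        + (1 - 1 / real p) * (2 - 1 / real p) / 6)\<bar> \<le> 4 * real a * real b * (real p)\<^sup>2"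
    (is "\<bar>?S - real p ^ 3 / _ * ?E\<bar> \<le> _")
proof -
  define h where "h = (\<lambda>t::real. frac (real a * t) * frac (real b * t))"
  have "h (real x / real p) = real (a * x mod p) * real (b * x mod p) / (real p)\<^sup>2" for x
    using frac_of_nat_div[of "a * x" p] frac_of_nat_div[of "b * x" p]
    by (simp add: h_def power2_eq_square)
  then have coarse: "(\<Sum>x<p. h (real x / real p)) = ?S / (real p)\<^sup>2"
    by (simp add: sum_divide_distrib)
  have "real a * (real x / real (p * (a * b))) = real x / real (b * p)"
    "real b * (real x / real (p * (a * b))) = real x / real (a * p)" for x
    using assms by (simp_all add: field_simps)
  then have "h (real x / real (p * (a * b))) =
      real (x mod (a * p)) * real (x mod (b * p)) / (real a * real b * (real p)\<^sup>2)" for x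
    unfolding h_def frac_of_nat_div by (simp only: frac_of_nat_div) (simp add: power2_eq_square mult_ac)
  then have "(\<Sum>x<p * (a * b). h (real x / real (p * (a * b)))) =
      (\<Sum>x<a * b * p. real (x mod (a * p)) * real (x mod (b * p))) / (real a * real b * (real p)\<^sup>2)"
    by (simp add: sum_divide_distrib mult.commute)
  also have "\<dots> = real p * ?E"
    using sum_mod_mult_mod[OF assms(1-3), of p] assms
    by (simp add: power2_eq_square power3_eq_cube)
  finally have "\<bar>real p * ?E - real (a * b) * (?S / (real p)\<^sup>2)\<bar> \<le> 4 * real a * real b * real (a * b)"
    using refine_grid_frac_product[of p "a * b" a b] coarse assms by (simp add: h_def)
  \<comment> \<open>Scaling by \<open>p^2 / (a * b)\<close> frees \<open>?S\<close> of its
    coefficient and cancels the factor \<open>a * b\<close> of the error bound.\<close>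
  then have "\<bar>real p * ?E - real (a * b) * (?S / (real p)\<^sup>2)\<bar> * ((real p)\<^sup>2 / real (a * b))
      \<le> 4 * real a * real b * real (a * b) * ((real p)\<^sup>2 / real (a * b))"
    by (rule mult_right_mono) simp
  also have "4 * real a * real b * real (a * b) * ((real p)\<^sup>2 / real (a * b)) = 4 * real a * real b * (real p)\<^sup>2"
    using assms by simp
  also have "\<bar>real p * ?E - real (a * b) * (?S / (real p)\<^sup>2)\<bar> * ((real p)\<^sup>2 / real (a * b))
      = \<bar>(real p * ?E - real (a * b) * (?S / (real p)\<^sup>2)) * ((real p)\<^sup>2 / real (a * b))\<bar>"
    by (simp add: abs_mult)
  also have "(real p * ?E - real (a * b) * (?S / (real p)\<^sup>2)) * ((real p)\<^sup>2 / real (a * b))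
      = real p ^ 3 / (real a * real b) * ?E - ?S"
  proof -
    \<comment> \<open>Proved for real variables, so that \<open>?E\<close> and \<open>?S\<close>
      stay atomic during simplification.\<close>
    have "(P * E - M * (S / P\<^sup>2)) * (P\<^sup>2 / M) = P ^ 3 / M * E - S" if "P \<noteq> 0" "M \<noteq> 0" for P E M S :: real
      using that by (simp add: field_simps power2_eq_square power3_eq_cube)
    from this[of "real p" "real (a * b)" ?E ?S] show ?thesis using assms by simp
  qed
  finally show ?thesis by (simp add: abs_minus_commute)
qed

section \<open>From the maximum to the product of residues\<close>

text \<open>Combine \<open>2 * max u v = u + v + \<bar>u - v\<bar>\<close> with
  \<open>p * \<bar>u - v\<bar> = (u - v)^2 + w * (p - w)\<close>. The second identity is unchanged
  when \<open>w\<close> is replaced by \<open>p - w\<close>, so one formula serves both orders of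
  \<open>u\<close> and \<open>v\<close>.\<close>

lemma max_mod_identity:
  fixes a b p x :: nat
  assumes "b < a" "p > 0"
  defines "u \<equiv> real (a * x mod p)" and "v \<equiv> real (b * x mod p)" and "w \<equiv> real ((a - b) * x mod p)"
  shows "2 * real p * max u v = real p * (u + v + w) + u\<^sup>2 + v\<^sup>2 - w\<^sup>2 - 2 * (u * v)"
proof -
  \<comment> \<open>By \<open>b < a\<close> the natural difference is not truncated, so over the
    integers \<open>w\<close> is the residue of \<open>u - v\<close>.\<close>
  have *: "int ((a - b) * x mod p) = (int (a * x mod p) - int (b * x mod p)) mod int p"
    using assms by (simp add: zmod_int of_nat_diff left_diff_distrib mod_diff_eq)
  show ?thesis
  proof (cases "b * x mod p \<le> a * x mod p")
    case True
    have "a * x mod p < p" using assms by simp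
    then have "(int (a * x mod p) - int (b * x mod p)) mod int p = int (a * x mod p) - int (b * x mod p)"
      using True by (intro mod_pos_pos_trivial) auto
    then have w: "w = u - v" using * unfolding u_def v_def w_def by linarith
    have max: "max u v = u" using True by (simp add: u_def v_def)
    show ?thesis unfolding w max by (simp add: power2_eq_square algebra_simps)
  next
    case False
    have "b * x mod p < p" using assms by simp
    \<comment> \<open>Here \<open>u - v\<close> is negative; adding \<open>p\<close> once brings it
      into the range of residues.\<close>
    then have "(int (a * x mod p) - int (b * x mod p) + int p) mod int p
        = int (a * x mod p) - int (b * x mod p) + int p"
      using False by (intro mod_pos_pos_trivial) auto
    then have w: "w = u - v + real p" using * unfolding u_def v_def w_def mod_add_self2 by linarith
    have max: "max u v = v" using False by (simp add: u_def v_def)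
    show ?thesis unfolding w max by (simp add: power2_eq_square algebra_simps)
  qed
qed

lemma Ma_commute: "Ma a b p = Ma b a p"
  by (simp add: Ma_def max.commute)

lemma Ma_mult_left:
  assumes "coprime c p" "p > 0"
  shows "Ma (c * a) (c * b) p = Ma a b p"
proof -
  have *: "rep_mod p (q * (c * x mod p)) = rep_mod p (c * q * x)" for q x
    by (simp add: rep_mod_def mod_mult_right_eq mult_ac)
  show ?thesis
    using sum_mult_mod[OF assms, of "\<lambda>x. max (rep_mod p (a * x)) (rep_mod p (b * x))"]
    by (simp add: Ma_def *)
qed

text \<open>The representatives in \<open>[1,p]\<close> and the remainders differ only on the zero
  class. As \<open>a\<close> and \<open>b\<close> are units, that class is met only at
  \<open>x = 0\<close>, where the maximum is \<open>p\<close> instead of \<open>0\<close>.\<close>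

lemma Ma_eq_sum_mod:
  assumes "coprime a p" "coprime b p" "p > 0"
  shows "Ma a b p = p + (\<Sum>x<p. max (a * x mod p) (b * x mod p))"
proof -
  have rep: "rep_mod p (q * x) = q * x mod p" if "coprime q p" "x \<in> {..<p} - {0}" for q x
  proof -
    have "\<not> p dvd q * x"
      using that by (auto simp: coprime_dvd_mult_right_iff coprime_commute dest: dvd_imp_le)
    then show ?thesis by (simp add: rep_mod_def mod_eq_0_iff_dvd)
  qed
  have "Ma a b p = p + (\<Sum>x\<in>{..<p} - {0}. max (rep_mod p (a * x)) (rep_mod p (b * x)))"
    unfolding Ma_def using assms(3) by (subst sum.remove[of _ 0]) (simp_all add: rep_mod_def)
  also have "(\<Sum>x\<in>{..<p} - {0}. max (rep_mod p (a * x)) (rep_mod p (b * x)))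
      = (\<Sum>x\<in>{..<p} - {0}. max (a * x mod p) (b * x mod p))"
    by (intro sum.cong refl) (simp only: rep[OF assms(1)] rep[OF assms(2)])
  also have "\<dots> = (\<Sum>x<p. max (a * x mod p) (b * x mod p))"
    using assms(3) by (subst (2) sum.remove[of _ 0]) simp_all
  finally show ?thesis .
qed

text \<open>Sum \<open>max_mod_identity\<close> over \<open>x\<close>. The multipliers
  \<open>a\<close>, \<open>b\<close> and \<open>a - b\<close> all permute the residues, so the three
  linear sums agree, and of the three sums of squares, with signs plus, plus, minus, one survives.
  The term \<open>2 * p^2\<close> comes from the extra \<open>p\<close> in
  \<open>Ma_eq_sum_mod\<close>.\<close>

lemma Ma_eq_sum_product:
  assumes "b < a" "coprime a p" "coprime b p" "coprime (a - b) p" "p > 0"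
  shows "2 * real p * real (Ma a b p) = 2 * (real p)\<^sup>2 + 3 * (real p)\<^sup>2 * (real p - 1) / 2
    + real p * (real p - 1) * (2 * real p - 1) / 6
    - 2 * (\<Sum>x<p. real (a * x mod p) * real (b * x mod p))"
proof -
  have lin: "(\<Sum>x<p. real (c * x mod p)) = real p * (real p - 1) / 2"
    and sq: "(\<Sum>x<p. (real (c * x mod p))\<^sup>2) = real p * (real p - 1) * (2 * real p - 1) / 6"
    if "coprime c p" for c
    using sum_mult_mod[OF that assms(5), of real] sum_mult_mod[OF that assms(5), of "\<lambda>x. (real x)\<^sup>2"]
    by (simp_all only: sum_lessThan_real sum_lessThan_real_squares)
  have "2 * real p * real (Ma a b p) = 2 * (real p)\<^sup>2
      + (\<Sum>x<p. 2 * real p * max (real (a * x mod p)) (real (b * x mod p)))"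
    using assms by (simp add: Ma_eq_sum_mod of_nat_max power2_eq_square algebra_simps sum_distrib_left)
  also have "\<dots> = 2 * (real p)\<^sup>2 + (real p * ((\<Sum>x<p. real (a * x mod p)) + (\<Sum>x<p. real (b * x mod p))
        + (\<Sum>x<p. real ((a - b) * x mod p)))
      + (\<Sum>x<p. (real (a * x mod p))\<^sup>2) + (\<Sum>x<p. (real (b * x mod p))\<^sup>2)
      - (\<Sum>x<p. (real ((a - b) * x mod p))\<^sup>2)
      - 2 * (\<Sum>x<p. real (a * x mod p) * real (b * x mod p)))"
    unfolding max_mod_identity[OF assms(1,5)]
    by (simp only: sum.distrib sum_subtractf sum_distrib_left[symmetric])
  also have "\<dots> = 2 * (real p)\<^sup>2 + 3 * (real p)\<^sup>2 * (real p - 1) / 2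
      + real p * (real p - 1) * (2 * real p - 1) / 6
      - 2 * (\<Sum>x<p. real (a * x mod p) * real (b * x mod p))"
    unfolding lin[OF assms(2)] lin[OF assms(3)] lin[OF assms(4)]
      sq[OF assms(2)] sq[OF assms(3)] sq[OF assms(4)]
    by (simp add: field_simps power2_eq_square)
  finally show ?thesis .
qed

section \<open>Limits along the primes\<close>

lemma eventually_primes_at_top_coprime:
  assumes "c > 0"
  shows "eventually (\<lambda>p. coprime c p) primes_at_top"
  unfolding primes_at_top_def eventually_inf_principal
  using eventually_gt_at_top[of c]
proof eventually_elim
  case (elim p)
  then show ?case
    using assms by (auto simp: coprime_commute[of c] intro!: prime_imp_coprime dest: dvd_imp_le)
qed

lemma tendsto_primes_at_topI: "(f \<longlongrightarrow> l) at_top \<Longrightarrow> (f \<longlongrightarrow> l) primes_at_top"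
  unfolding primes_at_top_def by (rule tendsto_mono) simp_all

lemma tendsto_Ma_coprime:
  assumes "coprime a b" "b < a" "b > 0"
  shows "((\<lambda>p. real (Ma a b p) / (real p)\<^sup>2) \<longlongrightarrow> 2 / 3 - 1 / (12 * real a * real b)) primes_at_top"
proof -
  define A B where "A = real a" and "B = real b"
  have AB: "A > 0" "B > 0" using assms by (simp_all add: A_def B_def)
  define E where "E = (\<lambda>p. (A - 1) * (B - 1) / 4 + (A + B - 2) * (1 - 1 / real p) / 4
        + (1 - 1 / real p) * (2 - 1 / real p) / 6)"
  define S where "S = (\<lambda>p. \<Sum>x<p. real (a * x mod p) * real (b * x mod p))"
  \<comment> \<open>This is \<open>Ma a b p / p^2\<close> with \<open>S p / p ^ 3\<close> replaced
    by its approximation \<open>E p / (A * B)\<close>.\<close>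
  define main where "main = (\<lambda>p. 1 / real p + 3 * (1 - 1 / real p) / 4
    + (1 - 1 / real p) * (2 - 1 / real p) / 12 - E p / (A * B))"
  have "(main \<longlongrightarrow> 0 + 3 * (1 - 0) / 4 + (1 - 0) * (2 - 0) / 12
      - ((A - 1) * (B - 1) / 4 + (A + B - 2) * (1 - 0) / 4 + (1 - 0) * (2 - 0) / 6) / (A * B)) at_top"
    unfolding main_def E_def using AB by (intro tendsto_intros lim_1_over_n) simp_all
  \<comment> \<open>\<open>E\<close> tends to \<open>A * B / 4 + 1 / 12\<close>, so the value is
    \<open>3 / 4 + 1 / 6 - 1 / 4 - 1 / (12 * A * B)\<close>.\<close>
  moreover have "0 + 3 * (1 - 0) / 4 + (1 - 0) * (2 - 0) / 12
      - ((A - 1) * (B - 1) / 4 + (A + B - 2) * (1 - 0) / 4 + (1 - 0) * (2 - 0) / 6) / (A * B)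
      = 2 / 3 - 1 / (12 * A * B)"
    using AB by (simp add: field_simps)
  ultimately have main: "(main \<longlongrightarrow> 2 / 3 - 1 / (12 * A * B)) primes_at_top"
    by (intro tendsto_primes_at_topI) simp
  have "eventually (\<lambda>p. prime p) primes_at_top"
    by (simp add: primes_at_top_def eventually_inf_principal)
  moreover have "eventually (\<lambda>p. coprime a p) primes_at_top" "eventually (\<lambda>p. coprime b p) primes_at_top"
    "eventually (\<lambda>p. coprime (a - b) p) primes_at_top"
    using assms by (auto intro!: eventually_primes_at_top_coprime)
  \<comment> \<open>The trailing factor \<open>1\<close> gives the bound the shape required by
    \<open>tendsto_0_le\<close>.\<close>
  ultimately have "eventually (\<lambda>p. norm (real (Ma a b p) / (real p)\<^sup>2 - main p) \<le> norm (4 * A * B / real p) * 1) primes_at_top"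
  proof eventually_elim
    case (elim p)
    then have p: "p > 0" by (simp add: prime_gt_0_nat)
    have M: "2 * real p * real (Ma a b p) = 2 * (real p)\<^sup>2 + 3 * (real p)\<^sup>2 * (real p - 1) / 2
        + real p * (real p - 1) * (2 * real p - 1) / 6 - 2 * S p"
      unfolding S_def using Ma_eq_sum_product[OF assms(2) elim(2-4) p] .
    have "real (Ma a b p) / (real p)\<^sup>2 = (2 * real p * real (Ma a b p)) / (2 * real p ^ 3)"
      using p by (simp add: power2_eq_square power3_eq_cube)
    also have "\<dots> = 1 / real p + 3 * (1 - 1 / real p) / 4
        + (1 - 1 / real p) * (2 - 1 / real p) / 12 - S p / real p ^ 3"
      unfolding M using p by (simp add: field_simps power2_eq_square power3_eq_cube)
    also have "\<dots> - main p = - ((S p - real p ^ 3 / (A * B) * E p) / real p ^ 3)"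
      using p AB by (simp add: main_def diff_divide_distrib)
    finally have "norm (real (Ma a b p) / (real p)\<^sup>2 - main p) = \<bar>S p - real p ^ 3 / (A * B) * E p\<bar> / real p ^ 3"
      by simp
    also have "\<dots> \<le> 4 * A * B * (real p)\<^sup>2 / real p ^ 3"
      using sum_mod_product_estimate[OF assms(1) _ assms(3) p] assms
      unfolding S_def A_def B_def E_def by (intro divide_right_mono) simp_all
    also have "\<dots> = norm (4 * A * B / real p) * 1"
      using p AB by (simp add: power2_eq_square power3_eq_cube)
    finally show ?case .
  qed
  then have "((\<lambda>p. real (Ma a b p) / (real p)\<^sup>2 - main p) \<longlongrightarrow> 0) primes_at_top"
    by (rule tendsto_0_le[OF tendsto_primes_at_topI[OF lim_const_over_n]])
  from tendsto_add[OF this main] show ?thesis by (simp add: A_def B_def)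
qed

text \<open>By symmetry \<open>q2 < q1\<close> may be assumed. Large primes do not divide the gcd,
  so it cancels from both multipliers without changing \<open>Ma\<close>.\<close>

lemma tendsto_Ma:
  assumes "q1 > 0" "q2 > 0" "q1 \<noteq> q2"
  shows "((\<lambda>p. real (Ma q1 q2 p) / (real p)\<^sup>2) \<longlongrightarrow>
    2 / 3 - (real (gcd q1 q2))\<^sup>2 / (12 * real q1 * real q2)) primes_at_top"
proof -
  have wlog: "((\<lambda>p. real (Ma q1 q2 p) / (real p)\<^sup>2) \<longlongrightarrow>
      2 / 3 - (real (gcd q1 q2))\<^sup>2 / (12 * real q1 * real q2)) primes_at_top"
    if q: "q2 < q1" "q2 > 0" for q1 q2
  proof -
    define g where "g = gcd q1 q2"
    have g: "g > 0" using q by (simp add: g_def)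
    obtain a b where ab: "q1 = g * a" "q2 = g * b" "coprime a b"
    proof
      show "q1 = g * (q1 div g)" "q2 = g * (q2 div g)" by (simp_all add: g_def)
      show "coprime (q1 div g) (q2 div g)" using q unfolding g_def by (intro div_gcd_coprime) simp
    qed
    have "((\<lambda>p. real (Ma a b p) / (real p)\<^sup>2) \<longlongrightarrow> 2 / 3 - 1 / (12 * real a * real b)) primes_at_top"
      using q ab by (intro tendsto_Ma_coprime) auto
    also have "2 / 3 - 1 / (12 * real a * real b) = 2 / 3 - (real g)\<^sup>2 / (12 * real q1 * real q2)"
      using g by (simp add: ab power2_eq_square)
    finally have lim: "((\<lambda>p. real (Ma a b p) / (real p)\<^sup>2) \<longlongrightarrow>
      2 / 3 - (real g)\<^sup>2 / (12 * real q1 * real q2)) primes_at_top" .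
    have "eventually (\<lambda>p. real (Ma a b p) / (real p)\<^sup>2 = real (Ma q1 q2 p) / (real p)\<^sup>2) primes_at_top"
      using eventually_primes_at_top_coprime[OF g]
    proof eventually_elim
      case (elim p)
      \<comment> \<open>At \<open>p = 0\<close> both quotients are \<open>0\<close> by the
        convention for division by zero.\<close>
      show ?case using elim
        by (cases "p = 0") (simp_all add: ab Ma_mult_left)
    qed
    from Lim_transform_eventually[OF lim this] show ?thesis by (simp add: g_def)
  qed
  show ?thesis
  proof (cases "q2 < q1")
    case True
    then show ?thesis using wlog assms by blast
  next
    case False
    then have "q1 < q2" using assms by simp
    from wlog[OF this assms(1)] show ?thesis
      by (simp add: Ma_commute[of q2] gcd.commute mult_ac)
  qed
qed

theorem theorem3p7:
  fixes q1 q2 :: nat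
  assumes "q1 > 0" and "q2 > 0" and "q1 \<noteq> q2"
  shows "\<exists>\<epsilon> :: nat \<Rightarrow> real. \<epsilon> \<in> o[primes_at_top](\<lambda>_. 1) \<and>
    (\<forall>p. prime p \<longrightarrow>
      real (Ma q1 q2 p) =
        (real p)\<^sup>2 * (2 / 3 - (real (gcd q1 q2))\<^sup>2 / (12 * real q1 * real q2)) * (1 + \<epsilon> p))"
proof -
  define c where "c = 2 / 3 - (real (gcd q1 q2))\<^sup>2 / (12 * real q1 * real q2)"
  \<comment> \<open>The bound \<open>gcd^2 \<le> q1 * q2\<close> gives
    \<open>c \<ge> 2 / 3 - 1 / 12\<close>, so dividing by \<open>c\<close> is legitimate and the
    limit becomes a relative error.\<close>
  have "gcd q1 q2 \<le> q1" "gcd q1 q2 \<le> q2" using assms by (simp_all add: gcd_le1_nat gcd_le2_nat)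
  then have "(real (gcd q1 q2))\<^sup>2 \<le> real q1 * real q2"
    unfolding power2_eq_square by (intro mult_mono) simp_all
  then have "(real (gcd q1 q2))\<^sup>2 / (12 * real q1 * real q2) \<le> 1 / 12"
    using assms by (simp add: field_simps)
  then have c: "c > 0" by (simp add: c_def)
  \<comment> \<open>Solving the claimed equation for \<open>\<epsilon> p\<close> makes it hold
    exactly at every prime; only the convergence to \<open>0\<close> is asymptotic.\<close>
  define \<epsilon> where "\<epsilon> = (\<lambda>p. real (Ma q1 q2 p) / (real p)\<^sup>2 / c - 1)"
  have "(\<epsilon> \<longlongrightarrow> c / c - 1) primes_at_top"
    unfolding \<epsilon>_def using c tendsto_Ma[OF assms] by (intro tendsto_intros) (simp_all add: c_def)
  then have "\<epsilon> \<in> o[primes_at_top](\<lambda>_. 1)"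
    using c by (intro smalloI_tendsto) simp_all
  moreover have "real (Ma q1 q2 p) = (real p)\<^sup>2 * c * (1 + \<epsilon> p)" if "prime p" for p
    using that c prime_gt_0_nat[of p] by (simp add: \<epsilon>_def)
  ultimately show ?thesis unfolding c_def by blast
qed

end
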